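(* Let $n\in\mathbb{N}$, let $\mathcal{T}_n$ be the set of ordered set partitions of $[n]$ and $\operatorname{UPF}_n$ the set of unit-interval parking functions of length $n$. Define $\psi:\mathcal{T}_n\to\operatorname{UPF}_n$ as follows: for $B_1/\cdots/B_k\in\mathcal{T}_n$, $\psi(B_1/\cdots/B_k)=(\alpha_1,\dots,\alpha_n)$ where, for each block $B_a=\{c_1<c_2<\dots<c_m\}$ with $s=|B_1|+\dots+|B_{a-1}|$, we set $\alpha_{c_1}=s+1$ and $\alpha_{c_t}=s+t-1$ for $2\le t\le m$. Define $\phi:\operatorname{UPF}_n\to\mathcal{T}_n$ as follows: for $\alpha\in\operatorname{UPF}_n$, let $\sigma(j)$ denote the car that parks in spot $j$, and let $b_1<\dots<b_k=n$ be the breakpoints of $\alpha$ ($b_0=0$); then $\phi(\alpha)=\{\sigma(1),\dots,\sigma(b_1)\}/\{\sigma(b_1+1),\dots,\sigma(b_2)\}/\cdots/\{\sigma(b_{k-1}+1),\dots,\sigma(b_k)\}$. Then $\psi$ is well defined into $\operatorname{UPF}_n$, and $\psi$ and $\phi$ are mutually inverse bijections between $\mathcal{T}_n$ and $\operatorname{UPF}_n$.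
   Context: An ordered set partition of $[n]$ is an ordered list $(B_1,\dots,B_k)$ of pairwise disjoint nonempty subsets (blocks) of $[n]$ whose union is $[n]$, written $B_1/B_2/\cdots/B_k$. A parking function of length $n$ is $\alpha=(a_1,\dots,a_n)\in[n]^n$ such that, when cars $1,\dots,n$ arrive in order on a one-way street with spots $1,\dots,n$ and car $i$ parks in the first unoccupied spot $\ge a_i$, every car parks. Car $i$'s displacement is (spot it parks in) $-a_i$; a unit-interval parking function is one in which every car has displacement at most $1$. $\alpha$ has a breakpoint at $k$ if $|\{i:a_i\le k\}|=k$. *)

theory Defs
  imports Main "HOL-Library.FuncSet" "HOL-Library.Disjoint_Sets"
begin

definition ordered_set_partitions :: "nat \<Rightarrow> nat set list set" where
  "ordered_set_partitions n = {Bs. distinct Bs \<and> partition_on {1..n} (set Bs)}"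

text \<open>
  A preference vector in \<open>[n]\<^sup>n\<close> is an element of \<open>{1..n} \<rightarrow>\<^sub>E {1..n}\<close>, so that equality of
  vectors is equality of functions; cars and spots are numbered from 1.
\<close>

definition first_free :: "nat \<Rightarrow> nat set \<Rightarrow> nat \<Rightarrow> nat option" where
  "first_free n occ p =
     (if {p..n} - occ = {} then None else Some (Min ({p..n} - occ)))"

text \<open>\<open>occupied n \<alpha> i\<close> is the set of spots taken once cars \<open>1, \<dots>, i\<close> have arrived; a car that
  finds no free spot leaves the street.\<close>

primrec occupied :: "nat \<Rightarrow> (nat \<Rightarrow> nat) \<Rightarrow> nat \<Rightarrow> nat set" where
  "occupied n \<alpha> 0 = {}"
| "occupied n \<alpha> (Suc i) =
     occupied n \<alpha> i \<union> set_option (first_free n (occupied n \<alpha> i) (\<alpha> (Suc i)))"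

definition spot :: "nat \<Rightarrow> (nat \<Rightarrow> nat) \<Rightarrow> nat \<Rightarrow> nat option" where
  "spot n \<alpha> i = first_free n (occupied n \<alpha> (i - 1)) (\<alpha> i)"

definition parking_functions :: "nat \<Rightarrow> (nat \<Rightarrow> nat) set" where
  "parking_functions n =
     {\<alpha> \<in> {1..n} \<rightarrow>\<^sub>E {1..n}. \<forall>i\<in>{1..n}. spot n \<alpha> i \<noteq> None}"

text \<open>The subtraction never truncates, since a car parks at or after its preferred spot.\<close>

definition displacement :: "nat \<Rightarrow> (nat \<Rightarrow> nat) \<Rightarrow> nat \<Rightarrow> nat" where
  "displacement n \<alpha> i = the (spot n \<alpha> i) - \<alpha> i"

definition UPF :: "nat \<Rightarrow> (nat \<Rightarrow> nat) set" where
  "UPF n = {\<alpha> \<in> parking_functions n. \<forall>i\<in>{1..n}. displacement n \<alpha> i \<le> 1}"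

definition breakpoints :: "nat \<Rightarrow> (nat \<Rightarrow> nat) \<Rightarrow> nat set" where
  "breakpoints n \<alpha> = {k \<in> {1..n}. card {i \<in> {1..n}. \<alpha> i \<le> k} = k}"

definition car_in_spot :: "nat \<Rightarrow> (nat \<Rightarrow> nat) \<Rightarrow> nat \<Rightarrow> nat" where
  "car_in_spot n \<alpha> j = (THE i. i \<in> {1..n} \<and> spot n \<alpha> i = Some j)"

text \<open>In \<open>psi\<close>, \<open>a\<close> is the (0-based) position of the block containing the car \<open>c\<close>, and \<open>t\<close> is the
  (1-based) position of \<open>c\<close> in the increasing enumeration of that block.\<close>

definition psi :: "nat \<Rightarrow> nat set list \<Rightarrow> (nat \<Rightarrow> nat)" where
  "psi n Bs = (\<lambda>c\<in>{1..n}.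
     let a = (THE a. a < length Bs \<and> c \<in> Bs ! a);
         s = (\<Sum>b<a. card (Bs ! b));
         t = (THE t. t \<in> {1..card (Bs ! a)} \<and> sorted_list_of_set (Bs ! a) ! (t - 1) = c)
     in if t = 1 then s + 1 else s + t - 1)"

text \<open>In \<open>phi\<close>, the list \<open>b\<close> is \<open>[b\<^sub>0, b\<^sub>1, \<dots>, b\<^sub>k]\<close> with \<open>b\<^sub>0 = 0\<close>.\<close>

definition phi :: "nat \<Rightarrow> (nat \<Rightarrow> nat) \<Rightarrow> nat set list" where
  "phi n \<alpha> =
     (let b = 0 # sorted_list_of_set (breakpoints n \<alpha>)
      in map (\<lambda>t. car_in_spot n \<alpha> ` {b ! t <.. b ! Suc t}) [0..<length b - 1])"

end

theory Submission
  imports Defs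
begin

text \<open>
  Both sides of the bijection are codings of the same data: the word \<open>\<sigma>\<close> of cars read along the
  street, with bars at positions \<open>K\<close> that include every descent of \<open>\<sigma>\<close>. The segments of \<open>\<sigma>\<close>
  between consecutive bars form an ordered set partition, from which \<open>\<sigma>\<close> is recovered by sorting
  each block. On the other hand, let the car in spot \<open>k + 1\<close> prefer this spot if \<open>k \<in> K\<close> and spot
  \<open>k\<close> otherwise; in the latter case it arrives after its left neighbour and is displaced by one.
  These preferences have outcome \<open>\<sigma>\<close>, and their breakpoints are the positive elements of \<open>K\<close>.
\<close>

section \<open>Parking outcomes\<close>

lemma first_free_eq_Some_iff:
  "first_free n occ p = Some j \<longleftrightarrow> j \<in> {p..n} - occ \<and> {p..<j} \<subseteq> occ"
proof (cases "{p..n} - occ = {}")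
  case False
  then have "first_free n occ p = Some j \<longleftrightarrow>
      j \<in> {p..n} - occ \<and> (\<forall>k\<in>{p..n} - occ. j \<le> k)"
    by (auto simp: first_free_def Min_eq_iff)
  also have "\<dots> \<longleftrightarrow> j \<in> {p..n} - occ \<and> {p..<j} \<subseteq> occ"
    by (rule conj_cong[OF refl]) (force simp: subset_iff not_le[symmetric])
  finally show ?thesis .
qed (auto simp: first_free_def)

lemma mem_occupied_iff: "j \<in> occupied n \<alpha> i \<longleftrightarrow> (\<exists>i'\<in>{1..i}. spot n \<alpha> i' = Some j)"
  by (induction i) (auto simp: spot_def atLeastAtMostSuc_conv)

lemma spot_eq_Some_iff:
  assumes "i > 0"
  shows "spot n \<alpha> i = Some j \<longleftrightarrow> j \<in> {\<alpha> i..n} \<and> (\<forall>i'\<in>{1..<i}. spot n \<alpha> i' \<noteq> Some j) \<and>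
    (\<forall>k\<in>{\<alpha> i..<j}. \<exists>i'\<in>{1..<i}. spot n \<alpha> i' = Some k)"
proof -
  have "{1..i - 1} = {1..<i}" using assms by auto
  then show ?thesis
    unfolding spot_def[of n \<alpha> i] first_free_eq_Some_iff
    by (auto simp: mem_occupied_iff subset_iff)
qed

lemma spot_inject:
  assumes "spot n \<alpha> i = Some j" "spot n \<alpha> i' = Some j" "i > 0" "i' > 0"
  shows "i = i'"
proof (rule ccontr)
  assume "i \<noteq> i'"
  then consider "i \<in> {1..<i'}" | "i' \<in> {1..<i}" using assms by fastforce
  then show False
    using assms spot_eq_Some_iff[of i n \<alpha> j] spot_eq_Some_iff[of i' n \<alpha> j] by cases blast+
qed

lemma car_in_spot_eq:
  assumes "i \<in> {1..n}" "spot n \<alpha> i = Some j"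
  shows "car_in_spot n \<alpha> j = i"
  unfolding car_in_spot_def
proof (rule the_equality)
  fix i' assume "i' \<in> {1..n} \<and> spot n \<alpha> i' = Some j"
  with assms spot_inject[of n \<alpha> i' j i] show "i' = i" by simp
qed (use assms in simp)

locale parking_outcome =
  fixes n :: nat and \<alpha> \<sigma> :: "nat \<Rightarrow> nat"
  assumes pref: "\<alpha> \<in> {1..n} \<rightarrow>\<^sub>E {1..n}"
    and outcome: "bij_betw \<sigma> {1..n} {1..n}"
    and pref_le: "j \<in> {1..n} \<Longrightarrow> \<alpha> (\<sigma> j) \<le> j"
    and passed_earlier: "j \<in> {1..n} \<Longrightarrow> k \<in> {\<alpha> (\<sigma> j)..<j} \<Longrightarrow> \<sigma> k < \<sigma> j"
begin

lemma car_mem: "j \<in> {1..n} \<Longrightarrow> \<sigma> j \<in> {1..n}"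
  using outcome by (rule bij_betwE[rule_format])

lemma pref_mem: "j \<in> {1..n} \<Longrightarrow> \<alpha> (\<sigma> j) \<in> {1..n}"
  using pref car_mem by blast

lemma carE:
  assumes "i \<in> {1..n}"
  obtains j where "j \<in> {1..n}" "i = \<sigma> j"
  using assms outcome by (metis bij_betw_imp_surj_on imageE)

lemma spot_car: "j \<in> {1..n} \<Longrightarrow> spot n \<alpha> (\<sigma> j) = Some j"
proof (induction "\<sigma> j" arbitrary: j rule: less_induct)
  case less
  have "spot n \<alpha> i \<noteq> Some j" if i_earlier: "i \<in> {1..<\<sigma> j}" for i
  proof -
    have "i \<in> {1..n}" using i_earlier car_mem[OF less.prems] by auto
    then obtain j' where "j' \<in> {1..n}" "i = \<sigma> j'" by (rule carE)
    with less.hyps[of j'] i_earlier show ?thesis by auto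
  qed
  moreover have "\<exists>i\<in>{1..<\<sigma> j}. spot n \<alpha> i = Some k"
    if k_passed: "k \<in> {\<alpha> (\<sigma> j)..<j}" for k
  proof -
    have "k \<in> {1..n}" using k_passed less.prems pref_mem[OF less.prems] by auto
    moreover have "\<sigma> k < \<sigma> j" using less.prems k_passed by (rule passed_earlier)
    ultimately show ?thesis using less.hyps[of k] car_mem[of k] by (intro bexI[of _ "\<sigma> k"]) auto
  qed
  ultimately show ?case
    using less.prems car_mem[OF less.prems] pref_le by (subst spot_eq_Some_iff) auto
qed

lemma car_in_spot: "j \<in> {1..n} \<Longrightarrow> car_in_spot n \<alpha> j = \<sigma> j"
  by (rule car_in_spot_eq[OF car_mem spot_car])

lemma mem_parking_functions: "\<alpha> \<in> parking_functions n"
proof -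
  have "spot n \<alpha> i \<noteq> None" if "i \<in> {1..n}" for i
  proof -
    from that obtain j where "j \<in> {1..n}" "i = \<sigma> j" by (rule carE)
    with spot_car show ?thesis by simp
  qed
  with pref show ?thesis by (simp add: parking_functions_def)
qed

lemma breakpoints_eq: "breakpoints n \<alpha> = {k \<in> {1..n}. \<forall>j\<in>{k<..n}. k < \<alpha> (\<sigma> j)}"
  unfolding breakpoints_def
proof (rule Collect_cong, rule conj_cong[OF refl])
  fix k assume k_mem: "k \<in> {1..n}"
  let ?J = "{j \<in> {1..n}. \<alpha> (\<sigma> j) \<le> k}"
  have "{i \<in> \<sigma> ` {1..n}. \<alpha> i \<le> k} = \<sigma> ` ?J" by auto
  then have "{i \<in> {1..n}. \<alpha> i \<le> k} = \<sigma> ` ?J"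
    unfolding bij_betw_imp_surj_on[OF outcome] .
  then have card_eq: "card {i \<in> {1..n}. \<alpha> i \<le> k} = card ?J"
    using inj_on_subset[OF bij_betw_imp_inj_on[OF outcome], of ?J]
    by (simp only: card_image Collect_restrict)
  have initial_subset: "{1..k} \<subseteq> ?J"
  proof
    fix j assume "j \<in> {1..k}"
    with k_mem pref_le[of j] show "j \<in> ?J" by simp
  qed
  have "card ?J = k \<longleftrightarrow> ?J = {1..k}" using card_subset_eq[OF _ initial_subset] by auto
  also have "\<dots> \<longleftrightarrow> (\<forall>j\<in>{k<..n}. k < \<alpha> (\<sigma> j))"
    using initial_subset by (auto simp: set_eq_iff not_le[symmetric])
  finally show "card {i \<in> {1..n}. \<alpha> i \<le> k} = k \<longleftrightarrow> (\<forall>j\<in>{k<..n}. k < \<alpha> (\<sigma> j))"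
    unfolding card_eq .
qed

end

lemma bij_betw_spot:
  assumes "\<alpha> \<in> parking_functions n"
  shows "bij_betw (\<lambda>i. the (spot n \<alpha> i)) {1..n} {1..n}"
proof -
  let ?p = "\<lambda>i. the (spot n \<alpha> i)"
  have spot_eq: "spot n \<alpha> i = Some (?p i)" if "i \<in> {1..n}" for i
    using assms that by (auto simp: parking_functions_def)
  have "?p ` {1..n} \<subseteq> {1..n}"
  proof (rule image_subsetI)
    fix i assume i_mem: "i \<in> {1..n}"
    then have "\<alpha> i \<in> {1..n}" using assms by (auto simp: parking_functions_def)
    then show "?p i \<in> {1..n}"
      using spot_eq[OF i_mem] spot_eq_Some_iff[of i n \<alpha> "?p i"] i_mem by auto
  qed
  moreover have "inj_on ?p {1..n}"
  proof (rule inj_onI)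
    fix i i' assume "i \<in> {1..n}" "i' \<in> {1..n}" "?p i = ?p i'"
    with spot_eq[of i] spot_eq[of i'] show "i = i'" by (intro spot_inject[of n \<alpha> i "?p i" i']) auto
  qed
  ultimately show ?thesis using endo_inj_surj[of "{1..n}" ?p] by (simp add: bij_betw_def)
qed

lemma
  assumes pf: "\<alpha> \<in> parking_functions n" and j_mem: "j \<in> {1..n}"
  shows car_in_spot_mem: "car_in_spot n \<alpha> j \<in> {1..n}"
    and spot_car_in_spot: "spot n \<alpha> (car_in_spot n \<alpha> j) = Some j"
proof -
  from bij_betw_spot[OF pf] j_mem obtain i where i_mem: "i \<in> {1..n}" and "the (spot n \<alpha> i) = j"
    unfolding bij_betw_def by (metis imageE)
  with pf have spot_i: "spot n \<alpha> i = Some j" by (auto simp: parking_functions_def)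
  with i_mem have "car_in_spot n \<alpha> j = i" by (rule car_in_spot_eq)
  with i_mem spot_i
  show "car_in_spot n \<alpha> j \<in> {1..n}" "spot n \<alpha> (car_in_spot n \<alpha> j) = Some j" by simp_all
qed

lemma parking_outcome_car_in_spot:
  assumes pf: "\<alpha> \<in> parking_functions n"
  shows "parking_outcome n \<alpha> (car_in_spot n \<alpha>)"
proof
  let ?\<sigma> = "car_in_spot n \<alpha>"
  show "\<alpha> \<in> {1..n} \<rightarrow>\<^sub>E {1..n}" using pf by (simp add: parking_functions_def)
  have "inj_on ?\<sigma> {1..n}"
    using spot_car_in_spot[OF pf] by (intro inj_on_inverseI[of _ "\<lambda>i. the (spot n \<alpha> i)"]) simp
  moreover have "?\<sigma> ` {1..n} \<subseteq> {1..n}" using car_in_spot_mem[OF pf] by blast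
  ultimately show "bij_betw ?\<sigma> {1..n} {1..n}"
    using endo_inj_surj[of "{1..n}" ?\<sigma>] by (simp add: bij_betw_def)
  fix j assume "j \<in> {1..n}"
  note car_mem = car_in_spot_mem[OF pf this] and spot_car = spot_car_in_spot[OF pf this]
  have passed: "j \<in> {\<alpha> (?\<sigma> j)..n} \<and>
      (\<forall>k\<in>{\<alpha> (?\<sigma> j)..<j}. \<exists>i\<in>{1..<?\<sigma> j}. spot n \<alpha> i = Some k)"
    using spot_car car_mem spot_eq_Some_iff[of "?\<sigma> j" n \<alpha> j] by auto
  then show "\<alpha> (?\<sigma> j) \<le> j" by simp
  fix k assume "k \<in> {\<alpha> (?\<sigma> j)..<j}"
  with passed obtain i where i_earlier: "i \<in> {1..<?\<sigma> j}" "spot n \<alpha> i = Some k" by blast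
  then have "?\<sigma> k = i" using car_mem by (intro car_in_spot_eq) auto
  with i_earlier show "?\<sigma> k < ?\<sigma> j" by simp
qed

locale unit_interval_outcome = parking_outcome +
  assumes le_Suc_pref: "j \<in> {1..n} \<Longrightarrow> j \<le> Suc (\<alpha> (\<sigma> j))"
begin

lemma mem_UPF: "\<alpha> \<in> UPF n"
proof -
  have "displacement n \<alpha> i \<le> 1" if "i \<in> {1..n}" for i
  proof -
    from that obtain j where "j \<in> {1..n}" "i = \<sigma> j" by (rule carE)
    with spot_car le_Suc_pref[of j] show ?thesis by (simp add: displacement_def)
  qed
  with mem_parking_functions show ?thesis by (simp add: UPF_def)
qed

lemma mem_breakpoints_iff:
  "k \<in> breakpoints n \<alpha> \<longleftrightarrow> k \<in> {1..n} \<and> (k = n \<or> \<alpha> (\<sigma> (Suc k)) = Suc k)"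
proof (cases "k \<in> {1..<n}")
  case True
  have "(\<forall>j\<in>{k<..n}. k < \<alpha> (\<sigma> j)) \<longleftrightarrow> k < \<alpha> (\<sigma> (Suc k))"
  proof (intro iffI ballI)
    fix j assume "k < \<alpha> (\<sigma> (Suc k))" "j \<in> {k<..n}"
    then show "k < \<alpha> (\<sigma> j)" using le_Suc_pref[of j] by (cases "j = Suc k") auto
  qed (use True in auto)
  also have "\<dots> \<longleftrightarrow> \<alpha> (\<sigma> (Suc k)) = Suc k" using pref_le[of "Suc k"] True by auto
  finally show ?thesis using True by (auto simp: breakpoints_eq)
qed (auto simp: breakpoints_eq)

end

lemma unit_interval_outcome_car_in_spot:
  assumes "\<alpha> \<in> UPF n"
  shows "unit_interval_outcome n \<alpha> (car_in_spot n \<alpha>)"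
proof -
  interpret parking_outcome n \<alpha> "car_in_spot n \<alpha>"
    using assms by (intro parking_outcome_car_in_spot) (simp add: UPF_def)
  show ?thesis
  proof
    fix j assume j_mem: "j \<in> {1..n}"
    have "displacement n \<alpha> (car_in_spot n \<alpha> j) \<le> 1"
      using assms car_mem[OF j_mem] by (simp add: UPF_def)
    then show "j \<le> Suc (\<alpha> (car_in_spot n \<alpha> j))"
      using spot_car[OF j_mem] by (simp add: displacement_def)
  qed
qed

section \<open>Ordered set partitions\<close>

definition offset :: "nat set list \<Rightarrow> nat \<Rightarrow> nat" where
  "offset Bs a = (\<Sum>b<a. card (Bs ! b))"

lemma offset_0 [simp]: "offset Bs 0 = 0"
  and offset_Suc [simp]: "offset Bs (Suc a) = offset Bs a + card (Bs ! a)"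
  by (simp_all add: offset_def)

lemma partition_on_ordered_set_partition:
  "Bs \<in> ordered_set_partitions n \<Longrightarrow> partition_on {1..n} (set Bs)"
  by (simp add: ordered_set_partitions_def)

lemma
  assumes "Bs \<in> ordered_set_partitions n" "a < length Bs"
  shows block_subset: "Bs ! a \<subseteq> {1..n}"
    and finite_block: "finite (Bs ! a)"
    and block_nonempty: "Bs ! a \<noteq> {}"
proof -
  note partition = partition_on_ordered_set_partition[OF assms(1)]
  show "Bs ! a \<subseteq> {1..n}" using partition_onD1[OF partition] nth_mem[OF assms(2)] by blast
  then show "finite (Bs ! a)" using finite_subset by blast
  show "Bs ! a \<noteq> {}" using partition_onD3[OF partition] nth_mem[OF assms(2)] by metis
qed

lemma block_unique:
  assumes osp: "Bs \<in> ordered_set_partitions n"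
    and "a < length Bs" "a' < length Bs" "c \<in> Bs ! a" "c \<in> Bs ! a'"
  shows "a = a'"
proof -
  have "Bs ! a = Bs ! a'"
    using disjointD[OF partition_onD2[OF partition_on_ordered_set_partition[OF osp]]] assms nth_mem
    by (metis disjoint_iff)
  with assms show ?thesis by (simp add: ordered_set_partitions_def nth_eq_iff_index_eq)
qed

lemma psi_nth:
  assumes osp: "Bs \<in> ordered_set_partitions n"
    and a_less: "a < length Bs" and t_less: "t < card (Bs ! a)"
  shows "psi n Bs (sorted_list_of_set (Bs ! a) ! t) = offset Bs a + (if t = 0 then 1 else t)"
proof -
  let ?l = "sorted_list_of_set (Bs ! a)"
  have nth_mem_block: "?l ! t \<in> Bs ! a"
    using t_less finite_block[OF osp a_less] nth_mem[of t ?l] by simp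
  then have "?l ! t \<in> {1..n}" using block_subset[OF osp a_less] by blast
  moreover have "(THE a'. a' < length Bs \<and> ?l ! t \<in> Bs ! a') = a"
    using a_less nth_mem_block block_unique[OF osp] by blast
  moreover have "(THE u. u \<in> {1..card (Bs ! a)} \<and> ?l ! (u - 1) = ?l ! t) = Suc t"
    using t_less by (intro the_equality) (auto simp: nth_eq_iff_index_eq)
  ultimately show ?thesis by (simp only: psi_def restrict_apply' Let_def offset_def) simp
qed

lemma psi_extensional: "psi n Bs \<in> extensional {1..n}"
  by (simp add: psi_def)

section \<open>Segments of a word\<close>

definition segments :: "('a::linorder \<Rightarrow> 'b) \<Rightarrow> 'a list \<Rightarrow> 'b set list" where
  "segments f b = map (\<lambda>t. f ` {b ! t<..b ! Suc t}) [0..<length b - 1]"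

lemma phi_eq_segments:
  "phi n \<alpha> = segments (car_in_spot n \<alpha>) (0 # sorted_list_of_set (breakpoints n \<alpha>))"
  by (simp only: phi_def segments_def Let_def)

lemma length_segments [simp]: "length (segments f b) = length b - 1"
  by (simp add: segments_def)

lemma nth_segments [simp]: "Suc a < length b \<Longrightarrow> segments f b ! a = f ` {b ! a<..b ! Suc a}"
  by (simp add: segments_def)

lemma segments_singleton [simp]: "segments f [x] = []"
  by (simp add: segments_def)

lemma segments_Cons_Cons [simp]: "segments f (x # y # b) = f ` {x<..y} # segments f (y # b)"
  by (rule nth_equalityI) (auto simp: nth_Cons split: nat.split)

lemma sorted_le_last: "sorted xs \<Longrightarrow> x \<in> set xs \<Longrightarrow> x \<le> last xs"
  by (induction xs) auto

lemma segments_cong: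
  assumes "sorted b" "b \<noteq> []" "\<And>j. j \<in> {hd b<..last b} \<Longrightarrow> f j = g j"
  shows "segments f b = segments g b"
  using assms
proof (induction b rule: induct_list012)
  case (3 x y b)
  have "sorted (y # b)" "x \<le> y" using "3.prems"(1) by auto
  then have "y \<le> last (y # b)" by (intro sorted_le_last) auto
  then have agree: "f j = g j" if "j \<in> {x<..y} \<union> {y<..last (y # b)}" for j
    using that \<open>x \<le> y\<close> by (intro "3.prems"(3)) auto
  then have "segments f (y # b) = segments g (y # b)"
    using \<open>sorted (y # b)\<close> by (intro "3.IH"(2)) auto
  moreover have "f ` {x<..y} = g ` {x<..y}" using agree by (intro image_cong) auto
  ultimately show ?case by simp
qed auto

lemma mem_segmentE:
  fixes b :: "'a::linorder list"
  assumes "b \<noteq> []" "j \<in> {hd b<..last b}"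
  obtains a where "Suc a < length b" "j \<in> {b ! a<..b ! Suc a}"
  using assms
proof (induction b arbitrary: thesis rule: induct_list012)
  case (3 x y b)
  show ?case
  proof (cases "j \<le> y")
    case True
    with "3.prems" show ?thesis by (intro "3.prems"(1)[of 0]) auto
  next
    case False
    then have "j \<in> {hd (y # b)<..last (y # b)}" using "3.prems"(3) by (simp add: not_le)
    with "3.IH"(2)[OF _ list.simps(3)]
    obtain a where "Suc a < length (y # b)" "j \<in> {(y # b) ! a<..(y # b) ! Suc a}" by blast
    then show ?thesis by (intro "3.prems"(1)[of "Suc a"]) auto
  qed
qed auto

lemma
  assumes "sorted_wrt (<) b" "b \<noteq> []" "inj_on f {hd b<..last b}"
  shows distinct_segments: "distinct (segments f b)"
    and partition_on_segments: "partition_on (f ` {hd b<..last b}) (set (segments f b))"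
proof -
  have "distinct (segments f b) \<and> partition_on (f ` {hd b<..last b}) (set (segments f b))"
    using assms
  proof (induction b rule: induct_list012)
    case (3 x y b)
    let ?z = "last (y # b)"
    have "sorted (y # b)" using "3.prems"(1) strict_sorted_iff[of "x # y # b"] by simp
    then have "y \<le> ?z" by (rule sorted_le_last) simp
    with "3.prems"(1) have xyz: "x < y" "y \<le> ?z" by auto
    then have split: "{x<..?z} = {x<..y} \<union> {y<..?z}" by auto
    have inj: "inj_on f {x<..?z}" using "3.prems"(3) by simp
    then have "inj_on f {y<..?z}" by (rule inj_on_subset) (use xyz in auto)
    with 3 have IH: "distinct (segments f (y # b))"
      "partition_on (f ` {y<..?z}) (set (segments f (y # b)))" by auto
    have "f ` {x<..y} \<inter> f ` {y<..?z} = f ` ({x<..y} \<inter> {y<..?z})"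
      by (rule inj_on_image_Int[OF inj, symmetric]) (use xyz in auto)
    then have disj: "f ` {x<..y} \<inter> f ` {y<..?z} = {}" by auto
    then have "f ` {x<..?z} - f ` {x<..y} = f ` {y<..?z}"
      unfolding split image_Un by blast
    moreover have "f ` {x<..y} \<notin> set (segments f (y # b))"
      using disj xyz partition_onD1[OF IH(2)] by fastforce
    ultimately show ?case
      using IH disj xyz partition_onD1[OF IH(2)]
      by (auto simp: partition_on_insert disjnt_def split)
  qed (auto simp: partition_on_empty)
  then show "distinct (segments f b)"
    "partition_on (f ` {hd b<..last b}) (set (segments f b))" by auto
qed

lemma offset_segments:
  assumes "sorted b" "b \<noteq> []" "inj_on f {hd b<..last b}" "a < length b"
  shows "hd b + offset (segments f b) a = b ! a"
  using assms(4)
proof (induction a)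
  case (Suc a)
  have bounds: "b ! a \<le> b ! Suc a" "hd b \<le> b ! a" "b ! Suc a \<le> last b"
    using assms Suc.prems by (auto simp: hd_conv_nth last_conv_nth sorted_nth_mono)
  then have "inj_on f {b ! a<..b ! Suc a}" by (intro inj_on_subset[OF assms(3)]) auto
  then have "card (f ` {b ! a<..b ! Suc a}) = b ! Suc a - b ! a" by (simp add: card_image)
  with Suc bounds show ?case by simp
qed (use assms in \<open>simp add: hd_conv_nth\<close>)

lemma not_mem_between_consecutive:
  fixes b :: "'a::linorder list"
  assumes "sorted b" "Suc a < length b" "b ! a < x" "x < b ! Suc a"
  shows "x \<notin> set b"
proof
  assume "x \<in> set b"
  then obtain i where "i < length b" "b ! i = x" by (metis in_set_conv_nth)
  with assms sorted_nth_mono[of b i a] sorted_nth_mono[of b "Suc a" i] show False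
    by (cases "i \<le> a") auto
qed

lemma sorted_list_of_set_image_greaterThanAtMost:
  fixes f :: "nat \<Rightarrow> 'a::linorder"
  assumes "\<And>k. x < k \<Longrightarrow> k < y \<Longrightarrow> f k < f (Suc k)"
  shows "sorted_list_of_set (f ` {x<..y}) = map f [Suc x..<Suc y]"
proof -
  let ?l = "map f [Suc x..<Suc y]"
  have "sorted_wrt (<) ?l"
    using assms by (simp add: sorted_wrt_iff_nth_Suc_transp del: upt_Suc)
  then have "sorted_list_of_set (set ?l) = ?l"
    unfolding strict_sorted_iff by (intro sorted_list_of_set.idem_if_sorted_distinct) auto
  moreover have "set ?l = f ` {x<..y}"
    by (simp only: set_map set_upt atLeastLessThanSuc_atLeastAtMost
        atLeastSucAtMost_greaterThanAtMost)
  ultimately show ?thesis by (simp only:)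
qed

section \<open>Barred permutations\<close>

locale barred_permutation =
  fixes n :: nat and K :: "nat set" and \<sigma> :: "nat \<Rightarrow> nat"
  assumes bars: "K \<subseteq> {..n}" "0 \<in> K" "n \<in> K"
    and perm: "bij_betw \<sigma> {1..n} {1..n}"
    and ascent: "k \<in> {1..<n} \<Longrightarrow> k \<notin> K \<Longrightarrow> \<sigma> k < \<sigma> (Suc k)"
begin

abbreviation cuts :: "nat list" where
  "cuts \<equiv> sorted_list_of_set K"

definition blocks :: "nat set list" where
  "blocks = segments \<sigma> cuts"

definition preferences :: "nat \<Rightarrow> nat" where
  "preferences = (\<lambda>c\<in>{1..n}. let j = inv_into {1..n} \<sigma> c in if j - 1 \<in> K then j else j - 1)"

lemma car_SucE:
  assumes "c \<in> {1..n}"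
  obtains k where "k < n" "c = \<sigma> (Suc k)"
proof -
  from assms perm obtain j where "j \<in> {1..n}" "c = \<sigma> j"
    by (metis bij_betw_imp_surj_on imageE)
  then show ?thesis by (intro that[of "j - 1"]) auto
qed

lemma preferences_car:
  assumes "k < n"
  shows "preferences (\<sigma> (Suc k)) = (if k \<in> K then Suc k else k)"
proof -
  have "Suc k \<in> {1..n}" using assms by simp
  then have "\<sigma> (Suc k) \<in> {1..n}" "inv_into {1..n} \<sigma> (\<sigma> (Suc k)) = Suc k"
    using bij_betwE[OF perm] inv_into_f_f[OF bij_betw_imp_inj_on[OF perm]] by blast+
  then show ?thesis by (simp add: preferences_def)
qed

lemma preferences_extensional: "preferences \<in> extensional {1..n}"
  by (simp add: preferences_def)

lemma preferences_eqI:
  assumes "\<beta> \<in> extensional {1..n}"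
    and "\<And>k. k < n \<Longrightarrow> \<beta> (\<sigma> (Suc k)) = (if k \<in> K then Suc k else k)"
  shows "\<beta> = preferences"
proof (rule extensionalityI[OF assms(1)])
  show "preferences \<in> extensional {1..n}" by (rule preferences_extensional)
  fix c assume "c \<in> {1..n}"
  then obtain k where "k < n" "c = \<sigma> (Suc k)" by (rule car_SucE)
  with assms(2) preferences_car show "\<beta> c = preferences c" by simp
qed

lemma finite_bars: "finite K"
  using bars(1) finite_subset by blast

lemma cuts_eq_Cons: "cuts = 0 # sorted_list_of_set (K - {0})"
proof -
  have "Min K = 0" using bars(2) finite_bars by (intro Min_eqI) auto
  with sorted_list_of_set_nonempty[of K] bars(2) finite_bars show ?thesis by auto
qed

lemma cuts_nonempty: "cuts \<noteq> []"
  by (simp add: cuts_eq_Cons)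

lemma hd_cuts: "hd cuts = 0"
  by (simp add: cuts_eq_Cons)

lemma last_cuts: "last cuts = n"
proof (rule antisym)
  show "n \<le> last cuts" using bars(3) finite_bars by (intro sorted_le_last) auto
  have "last cuts \<in> K" using last_in_set[OF cuts_nonempty] finite_bars by simp
  with bars(1) show "last cuts \<le> n" by auto
qed

lemma
  shows inj_on_street: "inj_on \<sigma> {hd cuts<..last cuts}"
    and image_street: "\<sigma> ` {hd cuts<..last cuts} = {1..n}"
  using perm
  by (simp_all add: hd_cuts last_cuts bij_betw_def flip: atLeastSucAtMost_greaterThanAtMost)

lemma blocks_in_ordered_set_partitions: "blocks \<in> ordered_set_partitions n"
  using distinct_segments[OF _ cuts_nonempty inj_on_street]
    partition_on_segments[OF _ cuts_nonempty inj_on_street]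
  by (simp add: blocks_def ordered_set_partitions_def image_street)

lemma offset_blocks: "a < length cuts \<Longrightarrow> offset blocks a = cuts ! a"
  using offset_segments[OF sorted_sorted_list_of_set cuts_nonempty inj_on_street]
  by (simp add: blocks_def hd_cuts)

lemma sorted_list_of_set_block:
  assumes "Suc a < length cuts"
  shows "sorted_list_of_set (blocks ! a) = map \<sigma> [Suc (cuts ! a)..<Suc (cuts ! Suc a)]"
proof -
  have "cuts ! Suc a \<le> n" using nth_mem[OF assms] bars(1) finite_bars by auto
  have "\<sigma> k < \<sigma> (Suc k)" if between: "cuts ! a < k" "k < cuts ! Suc a" for k
  proof (rule ascent)
    show "k \<in> {1..<n}" using between \<open>cuts ! Suc a \<le> n\<close> by auto
    show "k \<notin> K"
      using not_mem_between_consecutive[OF sorted_sorted_list_of_set assms between] finite_bars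
      by simp
  qed
  then have "sorted_list_of_set (\<sigma> ` {cuts ! a<..cuts ! Suc a}) =
      map \<sigma> [Suc (cuts ! a)..<Suc (cuts ! Suc a)]"
    by (rule sorted_list_of_set_image_greaterThanAtMost)
  then show ?thesis unfolding blocks_def nth_segments[OF assms] .
qed

lemma psi_blocks: "psi n blocks = preferences"
proof (rule preferences_eqI[OF psi_extensional])
  fix k assume "k < n"
  then obtain a where a_less: "Suc a < length cuts" and "Suc k \<in> {cuts ! a<..cuts ! Suc a}"
    using mem_segmentE[OF cuts_nonempty, of "Suc k"] by (auto simp: hd_cuts last_cuts)
  then have k_bounds: "cuts ! a \<le> k" "k < cuts ! Suc a" by auto
  define t where "t = k - cuts ! a"
  have k_eq: "k = cuts ! a + t" using k_bounds by (simp add: t_def)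
  have "t < card (blocks ! a)"
    using arg_cong[OF sorted_list_of_set_block[OF a_less], of length] k_bounds
    by (simp add: t_def)
  moreover have "sorted_list_of_set (blocks ! a) ! t = \<sigma> (Suc k)"
    using k_bounds k_eq by (simp add: sorted_list_of_set_block[OF a_less] del: upt_Suc)
  ultimately have "psi n blocks (\<sigma> (Suc k)) = cuts ! a + (if t = 0 then 1 else t)"
    using psi_nth[OF blocks_in_ordered_set_partitions, of a t] offset_blocks[of a] a_less
    by (simp add: blocks_def)
  moreover have "k \<in> K \<longleftrightarrow> t = 0"
    using not_mem_between_consecutive[OF sorted_sorted_list_of_set a_less, of k]
      nth_mem[of a cuts] a_less k_bounds k_eq finite_bars by (cases "t = 0") auto
  ultimately show "psi n blocks (\<sigma> (Suc k)) = (if k \<in> K then Suc k else k)"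
    using k_eq by auto
qed

sublocale unit_interval_outcome n preferences \<sigma>
proof
  have pref: "preferences (\<sigma> j) = (if j - 1 \<in> K then j else j - 1)" if "j \<in> {1..n}" for j
    using that preferences_car[of "j - 1"] by auto
  have "preferences \<in> {1..n} \<rightarrow> {1..n}"
  proof
    fix c assume "c \<in> {1..n}"
    then obtain k where "k < n" "c = \<sigma> (Suc k)" by (rule car_SucE)
    then show "preferences c \<in> {1..n}" using preferences_car bars(2) by (cases k) auto
  qed
  then show "preferences \<in> {1..n} \<rightarrow>\<^sub>E {1..n}"
    unfolding PiE_def using preferences_extensional by (rule IntI)
  show "bij_betw \<sigma> {1..n} {1..n}" by (rule perm)
  fix j assume j_mem: "j \<in> {1..n}"
  show "preferences (\<sigma> j) \<le> j" "j \<le> Suc (preferences (\<sigma> j))" using pref[OF j_mem] by auto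
  fix k assume "k \<in> {preferences (\<sigma> j)..<j}"
  then have "k = j - 1" "j - 1 \<notin> K" using pref[OF j_mem] by (auto split: if_splits)
  then have "j = Suc k" "k \<notin> K" using j_mem by auto
  moreover from this have "k \<noteq> 0" using bars(2) by metis
  ultimately show "\<sigma> k < \<sigma> j" using ascent[of k] j_mem by auto
qed

lemma breakpoints_preferences: "breakpoints n preferences = K - {0}"
proof (rule set_eqI)
  fix k show "k \<in> breakpoints n preferences \<longleftrightarrow> k \<in> K - {0}"
    using bars preferences_car[of k] unfolding mem_breakpoints_iff by (cases "k < n") auto
qed

lemma phi_preferences: "phi n preferences = blocks"
proof -
  have "phi n preferences = segments (car_in_spot n preferences) cuts"
    by (simp only: phi_eq_segments breakpoints_preferences cuts_eq_Cons)
  also have "\<dots> = blocks"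
    unfolding blocks_def
    by (rule segments_cong[OF sorted_sorted_list_of_set cuts_nonempty])
      (simp add: hd_cuts last_cuts car_in_spot)
  finally show ?thesis .
qed

end

lemma barred_permutation_UPF:
  assumes "\<alpha> \<in> UPF n"
  shows "barred_permutation n (insert 0 (breakpoints n \<alpha>)) (car_in_spot n \<alpha>)"
proof -
  interpret unit_interval_outcome n \<alpha> "car_in_spot n \<alpha>"
    using assms by (rule unit_interval_outcome_car_in_spot)
  show ?thesis
  proof
    show "insert 0 (breakpoints n \<alpha>) \<subseteq> {..n}" by (auto simp: breakpoints_def)
    show "n \<in> insert 0 (breakpoints n \<alpha>)" using mem_breakpoints_iff[of n] by auto
    fix k assume not_bar: "k \<in> {1..<n}" "k \<notin> insert 0 (breakpoints n \<alpha>)"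
    then have "\<alpha> (car_in_spot n \<alpha> (Suc k)) \<noteq> Suc k" by (simp add: mem_breakpoints_iff)
    with not_bar pref_le[of "Suc k"] show "car_in_spot n \<alpha> k < car_in_spot n \<alpha> (Suc k)"
      by (intro passed_earlier) auto
  qed (use outcome in auto)
qed

lemma preferences_breakpoints:
  assumes "\<alpha> \<in> UPF n"
  shows "barred_permutation.preferences n (insert 0 (breakpoints n \<alpha>)) (car_in_spot n \<alpha>) = \<alpha>"
proof -
  interpret unit_interval_outcome n \<alpha> "car_in_spot n \<alpha>"
    using assms by (rule unit_interval_outcome_car_in_spot)
  show ?thesis
  proof (rule barred_permutation.preferences_eqI[OF barred_permutation_UPF[OF assms], symmetric])
    fix k assume k_less: "k < n"
    let ?i = "car_in_spot n \<alpha> (Suc k)"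
    have "\<alpha> ?i \<in> {1..n}" "\<alpha> ?i \<le> Suc k" "k \<le> \<alpha> ?i"
      using k_less pref_mem[of "Suc k"] pref_le[of "Suc k"] le_Suc_pref[of "Suc k"] by auto
    then show "\<alpha> ?i = (if k \<in> insert 0 (breakpoints n \<alpha>) then Suc k else k)"
      using k_less by (auto simp: mem_breakpoints_iff)
  qed (use pref in \<open>simp add: PiE_def\<close>)
qed

lemma
  assumes "\<alpha> \<in> UPF n"
  shows phi_in_ordered_set_partitions: "phi n \<alpha> \<in> ordered_set_partitions n"
    and psi_phi: "psi n (phi n \<alpha>) = \<alpha>"
proof -
  interpret barred_permutation n "insert 0 (breakpoints n \<alpha>)" "car_in_spot n \<alpha>"
    using assms by (rule barred_permutation_UPF)
  show "phi n \<alpha> \<in> ordered_set_partitions n" "psi n (phi n \<alpha>) = \<alpha>"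
    using blocks_in_ordered_set_partitions psi_blocks phi_preferences
    unfolding preferences_breakpoints[OF assms] by simp_all
qed

section \<open>The word of an ordered set partition\<close>

lemma nth_concat:
  assumes "a < length xss" "t < length (xss ! a)"
  shows "concat xss ! ((\<Sum>b<a. length (xss ! b)) + t) = xss ! a ! t"
  using assms
proof (induction xss arbitrary: a)
  case (Cons xs xss)
  then show ?case
    by (cases a) (simp_all add: sum.lessThan_Suc_shift nth_append del: sum.lessThan_Suc)
qed simp

definition word :: "nat set list \<Rightarrow> nat \<Rightarrow> nat" where
  "word Bs j = concat (map sorted_list_of_set Bs) ! (j - 1)"

lemma word_nth:
  assumes "a < length Bs" "t < card (Bs ! a)"
  shows "word Bs (Suc (offset Bs a + t)) = sorted_list_of_set (Bs ! a) ! t"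
  using nth_concat[of a "map sorted_list_of_set Bs" t] assms by (simp add: word_def offset_def)

lemma distinct_concat_sorted_blocks:
  assumes osp: "Bs \<in> ordered_set_partitions n"
  shows "distinct (concat (map sorted_list_of_set Bs))"
proof (rule distinct_concat)
  have finite: "finite B" if "B \<in> set Bs" for B
    using that finite_block[OF osp] by (metis in_set_conv_nth)
  have "inj_on sorted_list_of_set (set Bs)"
    using finite by (intro inj_onI) (rule sorted_list_of_set_inject)
  with osp show "distinct (map sorted_list_of_set Bs)"
    by (simp add: distinct_map ordered_set_partitions_def)
  show "distinct l" if "l \<in> set (map sorted_list_of_set Bs)" for l
    using that by auto
  fix l l'
  assume "l \<in> set (map sorted_list_of_set Bs)" "l' \<in> set (map sorted_list_of_set Bs)" "l \<noteq> l'"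
  then obtain B B' where "B \<in> set Bs" "l = sorted_list_of_set B"
    "B' \<in> set Bs" "l' = sorted_list_of_set B'" "B \<noteq> B'" by auto
  with finite disjointD[OF partition_onD2[OF partition_on_ordered_set_partition[OF osp]]]
  show "set l \<inter> set l' = {}" by simp
qed

lemma
  assumes osp: "Bs \<in> ordered_set_partitions n"
  shows bij_betw_word: "bij_betw (word Bs) {1..n} {1..n}"
    and offset_length: "offset Bs (length Bs) = n"
proof -
  let ?w = "concat (map sorted_list_of_set Bs)"
  have "\<Union> (set Bs) = {1..n}" "\<forall>B\<in>set Bs. finite B"
    using partition_onD1[OF partition_on_ordered_set_partition[OF osp]] finite_block[OF osp]
    by (auto simp: in_set_conv_nth)
  then have set_w: "set ?w = {1..n}" by auto
  then have length_w: "length ?w = n"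
    using distinct_card[OF distinct_concat_sorted_blocks[OF osp]] by simp
  then show "offset Bs (length Bs) = n"
    by (simp add: offset_def length_concat comp_def sum_list_sum_nth atLeast0LessThan)
  have "bij_betw ((!) ?w) {..<n} {1..n}"
    using distinct_concat_sorted_blocks[OF osp] set_w length_w by (intro bij_betw_nth) auto
  moreover have "bij_betw (\<lambda>j. j - 1) {1..n} {..<n}" by (rule bij_betw_byWitness[of _ Suc]) auto
  ultimately have "bij_betw ((!) ?w \<circ> (\<lambda>j. j - 1)) {1..n} {1..n}" by (rule bij_betw_trans[rotated])
  then show "bij_betw (word Bs) {1..n} {1..n}" by (simp add: word_def comp_def cong: bij_betw_cong)
qed

abbreviation offsets :: "nat set list \<Rightarrow> nat list" where
  "offsets Bs \<equiv> map (offset Bs) [0..<Suc (length Bs)]"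

lemma segments_word:
  assumes osp: "Bs \<in> ordered_set_partitions n"
  shows "segments (word Bs) (offsets Bs) = Bs"
proof (rule nth_equalityI)
  fix a assume "a < length (segments (word Bs) (offsets Bs))"
  then have a_less: "a < length Bs" by simp
  have "{offset Bs a<..offset Bs (Suc a)} = (\<lambda>t. Suc (offset Bs a + t)) ` {..<card (Bs ! a)}"
  proof (intro equalityI subsetI)
    fix j assume "j \<in> {offset Bs a<..offset Bs (Suc a)}"
    then show "j \<in> (\<lambda>t. Suc (offset Bs a + t)) ` {..<card (Bs ! a)}"
      by (intro image_eqI[of _ _ "j - Suc (offset Bs a)"]) auto
  qed auto
  then have "word Bs ` {offset Bs a<..offset Bs (Suc a)} =
      (!) (sorted_list_of_set (Bs ! a)) ` {..<card (Bs ! a)}"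
    using word_nth[OF a_less] by (simp add: image_image)
  also have "\<dots> = Bs ! a"
    using finite_block[OF osp a_less] nth_image[of "card (Bs ! a)" "sorted_list_of_set (Bs ! a)"]
    by (simp add: atLeast0LessThan)
  finally show "segments (word Bs) (offsets Bs) ! a = Bs ! a"
    using a_less by (simp del: upt_Suc)
qed simp

lemma sorted_wrt_offsets:
  assumes osp: "Bs \<in> ordered_set_partitions n"
  shows "sorted_wrt (<) (offsets Bs)"
  using block_nonempty[OF osp] finite_block[OF osp]
  by (simp add: sorted_wrt_iff_nth_Suc_transp card_gt_0_iff del: upt_Suc)

lemma barred_permutation_word:
  assumes osp: "Bs \<in> ordered_set_partitions n"
  shows "barred_permutation n (set (offsets Bs)) (word Bs)"
proof
  have hd: "hd (offsets Bs) = 0" and last: "last (offsets Bs) = n"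
    using offset_length[OF osp] by (simp_all add: hd_map last_map del: upt_Suc offset_Suc)
  show "0 \<in> set (offsets Bs)" "n \<in> set (offsets Bs)"
    using hd_in_set[of "offsets Bs"] last_in_set[of "offsets Bs"] hd last by auto
  show "set (offsets Bs) \<subseteq> {..n}"
    using sorted_le_last[of "offsets Bs"] sorted_wrt_offsets[OF osp] last
    unfolding strict_sorted_iff by auto
  show "bij_betw (word Bs) {1..n} {1..n}" by (rule bij_betw_word[OF osp])
  fix k assume "k \<in> {1..<n}" and not_offset: "k \<notin> set (offsets Bs)"
  then obtain a where a_less: "Suc a < length (offsets Bs)"
    and k_mem: "k \<in> {offsets Bs ! a<..offsets Bs ! Suc a}"
    using mem_segmentE[of "offsets Bs" k] hd last by (auto simp del: upt_Suc)
  moreover have "k \<noteq> offsets Bs ! Suc a" using not_offset nth_mem[OF a_less] by metis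
  ultimately have between: "a < length Bs" "offset Bs a < k" "k < offset Bs a + card (Bs ! a)"
    by (auto simp del: upt_Suc)
  define t where "t = k - Suc (offset Bs a)"
  have k_eq: "k = Suc (offset Bs a + t)" and t_less: "Suc t < card (Bs ! a)"
    using between by (auto simp: t_def)
  have "sorted_list_of_set (Bs ! a) ! t < sorted_list_of_set (Bs ! a) ! Suc t"
    using t_less by (intro sorted_wrt_nth_less[OF strict_sorted_list_of_set]) auto
  then show "word Bs k < word Bs (Suc k)"
    using word_nth[OF between(1), of t] word_nth[OF between(1), of "Suc t"] k_eq t_less by simp
qed

lemma blocks_word:
  assumes osp: "Bs \<in> ordered_set_partitions n"
  shows "barred_permutation.blocks (set (offsets Bs)) (word Bs) = Bs"
proof -
  have "sorted_list_of_set (set (offsets Bs)) = offsets Bs"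
    using sorted_wrt_offsets[OF osp] unfolding strict_sorted_iff
    by (intro sorted_list_of_set.idem_if_sorted_distinct) auto
  then show ?thesis
    unfolding barred_permutation.blocks_def[OF barred_permutation_word[OF osp]]
    using segments_word[OF osp] by simp
qed

lemma
  assumes "Bs \<in> ordered_set_partitions n"
  shows psi_in_UPF: "psi n Bs \<in> UPF n"
    and phi_psi: "phi n (psi n Bs) = Bs"
proof -
  interpret barred_permutation n "set (offsets Bs)" "word Bs"
    using assms by (rule barred_permutation_word)
  show "psi n Bs \<in> UPF n" "phi n (psi n Bs) = Bs"
    using mem_UPF psi_blocks phi_preferences unfolding blocks_word[OF assms] by simp_all
qed

theorem theorem3p6:
  fixes n :: nat
  shows "psi n \<in> ordered_set_partitions n \<rightarrow> UPF n \<and>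
    phi n \<in> UPF n \<rightarrow> ordered_set_partitions n \<and>
    (\<forall>Bs\<in>ordered_set_partitions n. phi n (psi n Bs) = Bs) \<and>
    (\<forall>\<alpha>\<in>UPF n. psi n (phi n \<alpha>) = \<alpha>) \<and>
    bij_betw (psi n) (ordered_set_partitions n) (UPF n) \<and>
    bij_betw (phi n) (UPF n) (ordered_set_partitions n)"
proof -
  have "bij_betw (psi n) (ordered_set_partitions n) (UPF n)"
    using phi_psi psi_phi psi_in_UPF phi_in_ordered_set_partitions
    by (intro bij_betw_byWitness[of _ "phi n"]) blast+
  moreover have "bij_betw (phi n) (UPF n) (ordered_set_partitions n)"
    using phi_psi psi_phi psi_in_UPF phi_in_ordered_set_partitions
    by (intro bij_betw_byWitness[of _ "psi n"]) blast+
  ultimately show ?thesis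
    using phi_psi psi_phi psi_in_UPF phi_in_ordered_set_partitions by blast
qed

end
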